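(* Let $k\ge 1$. Let $\begin{bmatrix} M_0 & -c_0\\ r_0^T & 1\end{bmatrix}$ be a matrix in $\mathcal{M}_{k+1}\{-1,1\}$ whose determinant has the maximal absolute value $\Theta_{k+1}$, and let $N_0$ be a matrix in $\mathcal{M}_k\{-1,1\}$ whose determinant has the maximal absolute value $\Theta_k$, where $M_0$ is a square matrix of order $k$ and $c_0,r_0$ are column vectors of length $k$. Let $$v_0^T=\begin{bmatrix} r_0^T & r_0^T\end{bmatrix},\qquad \tilde c=\begin{bmatrix} c_0^T & c_0^T\end{bmatrix}^T,\qquad g_0(k,1)=\begin{bmatrix} M_0 & M_0\\ -N_0 & N_0\end{bmatrix}.$$ Then the design matrix $\begin{bmatrix} g_0(k,1) & -\tilde c\\ v_0^T & 1\end{bmatrix}$ is a d-optimal design in $\mathcal{G}_1(k,1)$. Furthermore, $$\left|\det\begin{bmatrix} g_0(k,1) & -\tilde c\\ v_0^T & 1\end{bmatrix}\right|=2^k\,\Theta_k\,\Theta_{k+1}.$$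
   Context: $1_m$ denotes the all-ones column vector of length $m$, and $*$ denotes the Schur (entrywise) product. For $m\ge 1$, $\mathcal{M}_m\{-1,1\}$ is the set of non-singular $m\times m$ matrices with entries in $\{-1,1\}$ whose first column is $1_m$, and $\Theta_m$ is the maximum of $|\det(M)|$ over $M\in\mathcal{M}_m\{-1,1\}$. $\mathcal{G}_1(k,1)$ is the set of saturated design matrices for the mean $F_0$, the main effects $F_1,\dots,F_k$, the two-factor interactions $F_{12},\dots,F_{1k}$ and one extra main effect $F_1^e$ in a two-level factorial experiment with $k+1$ factors. That is, it is the set of non-singular $(2k+1)\times(2k+1)$ matrices with entries in $\{-1,1\}$ whose columns are, in this order, $F_1,\dots,F_k,F_{11},F_{12},\dots,F_{1k},F_1^e$, where $F_{1j}=F_1*F_j$ for $1\le j\le k$ (so $F_{11}=F_0=1_{2k+1}$) and $F_1^e$ is an arbitrary $\{-1,1\}$-vector. A d-optimal design in $\mathcal{G}_1(k,1)$ is an element whose determinant has maximal absolute value among all elements of $\mathcal{G}_1(k,1)$. *)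

theory Defs
  imports "Jordan_Normal_Form.Determinant"
begin

text \<open>
  Indices are 0-based: the factor column \<open>F\<^sub>j\<close> is column \<open>j - 1\<close> of a design matrix.
\<close>

definition ones_vec :: "nat \<Rightarrow> real vec" where
  "ones_vec m = vec m (\<lambda>_. 1)"

definition schur_vec :: "real vec \<Rightarrow> real vec \<Rightarrow> real vec" where
  "schur_vec u v = vec (dim_vec u) (\<lambda>i. u $ i * v $ i)"

definition sign_mats :: "nat \<Rightarrow> real mat set" where
  "sign_mats m = {M \<in> carrier_mat m m. elements_mat M \<subseteq> {-1, 1} \<and> det M \<noteq> 0}"

definition M_set :: "nat \<Rightarrow> real mat set" where
  "M_set m = {M \<in> sign_mats m. col M 0 = ones_vec m}"

definition Theta :: "nat \<Rightarrow> real" where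
  "Theta m = Max ((\<lambda>M. \<bar>det M\<bar>) ` M_set m)"

text \<open>
  Column \<open>k + j\<close> is the interaction of \<open>F\<^sub>1\<close> with \<open>F\<close> of index \<open>j + 1\<close>; for \<open>j = 0\<close> it is the
  all-ones column of the mean, since the entries are \<open>\<plusminus>1\<close>. The last column, of index \<open>2 * k\<close>,
  is the unconstrained extra main effect.
\<close>

definition G1_set :: "nat \<Rightarrow> real mat set" where
  "G1_set k = {D \<in> sign_mats (2 * k + 1).
     \<forall>j<k. col D (k + j) = schur_vec (col D 0) (col D j)}"

definition d_optimal :: "real mat set \<Rightarrow> real mat \<Rightarrow> bool" where
  "d_optimal S D \<longleftrightarrow> D \<in> S \<and> (\<forall>E\<in>S. \<bar>det E\<bar> \<le> \<bar>det D\<bar>)"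

text \<open>\<open>bordered A c r\<close> has the block rows \<open>A, -c\<close> and \<open>r\<^sup>T, 1\<close>.\<close>

definition bordered :: "real mat \<Rightarrow> real vec \<Rightarrow> real vec \<Rightarrow> real mat" where
  "bordered A c r =
     four_block_mat A (mat_of_cols (dim_vec c) [- c]) (mat_of_row r) (1\<^sub>m 1)"

end

theory Submission
  imports Defs
begin

text \<open>
  In a design of \<open>G1_set k\<close> the columns \<open>k + j\<close> and \<open>j\<close> agree on the rows where the first
  factor \<open>F\<^sub>1\<close> is \<open>1\<close> and are opposite on the rows where it is \<open>-1\<close>. By pigeonhole some sign
  \<open>-s\<close> is taken by \<open>F\<^sub>1\<close> on at least \<open>k + 1\<close> rows; move \<open>k + 1\<close> of these to the bottom.
  Adding column \<open>k + j\<close> to \<open>s\<close> times column \<open>j\<close> kills the lower left block, so up to sign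
  the determinant is that of the upper left block times that of the last \<open>k + 1\<close> rows and columns.
  If a further row has sign \<open>-s\<close>, the upper left block has a zero row. Hence for a non-singular
  design exactly \<open>k\<close> rows have sign \<open>s\<close>, the upper left block is twice a matrix of \<open>M_set k\<close>,
  and the lower right block lies in \<open>M_set (k + 1)\<close>. The two factors can be
  chosen independently, which makes the bound sharp.
\<close>

section \<open>Row selection and zero rows\<close>

text \<open>A bijection from \<open>A\<close> to \<open>B\<close> is glued to one between the
  complements in \<open>S\<close>. This supplies the row permutation that moves chosen rows to the
  bottom.\<close>

lemma ex_permutes_image_eq:
  assumes "finite S" "A \<subseteq> S" "B \<subseteq> S" "card A = card B"
  shows "\<exists>p. p permutes S \<and> p ` A = B"
proof -
  have fin: "finite A" "finite B" using assms finite_subset by auto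
  obtain f where f: "bij_betw f A B"
    using finite_same_card_bij[OF fin assms(4)] by blast
  have "card (S - A) = card (S - B)"
    using assms fin by (simp add: card_Diff_subset)
  then obtain g where g: "bij_betw g (S - A) (S - B)"
    using finite_same_card_bij[of "S - A" "S - B"] assms(1) by auto
  define p where "p x = (if x \<in> A then f x else if x \<in> S then g x else x)" for x
  have pA: "bij_betw p A B"
    using f by (rule bij_betw_cong[THEN iffD1, rotated]) (simp add: p_def)
  have pB: "bij_betw p (S - A) (S - B)"
    using g by (rule bij_betw_cong[THEN iffD1, rotated]) (simp add: p_def)
  have "bij_betw p (A \<union> (S - A)) (B \<union> (S - B))"
    using bij_betw_combine[OF pA pB] by blast
  moreover have "A \<union> (S - A) = S" "B \<union> (S - B) = S" using assms by auto
  ultimately have "bij_betw p S S" by simp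
  then have "p permutes S"
    by (rule bij_imp_permutes) (use assms(2) in \<open>auto simp: p_def\<close>)
  moreover have "p ` A = B" using pA by (rule bij_betw_imp_surj_on)
  ultimately show ?thesis by blast
qed

lemma det_eq_0_if_zero_row:
  fixes A :: "'a :: comm_ring_1 mat"
  assumes "A \<in> carrier_mat n n" "i < n" "\<And>j. j < n \<Longrightarrow> A $$ (i, j) = 0"
  shows "det A = 0"
  unfolding laplace_expansion_row[OF assms(1,2)] using assms(3) by simp

section \<open>Entrywise membership criteria and finiteness\<close>

lemma elements_mat_subset_iff:
  assumes "A \<in> carrier_mat m n"
  shows "elements_mat A \<subseteq> S \<longleftrightarrow> (\<forall>i<m. \<forall>j<n. A $$ (i, j) \<in> S)"
  using assms by (auto dest!: elements_matD)

lemma M_set_iff: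
  "M \<in> M_set m \<longleftrightarrow> M \<in> carrier_mat m m \<and> (\<forall>i<m. \<forall>j<m. M $$ (i, j) \<in> {-1, 1}) \<and> det M \<noteq> 0
     \<and> (\<forall>i<m. M $$ (i, 0) = 1)"
proof (cases "M \<in> carrier_mat m m")
  case True
  have "col M 0 = ones_vec m \<longleftrightarrow> (\<forall>i<m. M $$ (i, 0) = 1)"
    using True by (cases "m = 0") (auto simp: vec_eq_iff ones_vec_def)
  then show ?thesis
    using elements_mat_subset_iff[OF True, of "{-1, 1}"] True
    unfolding M_set_def sign_mats_def by auto
qed (simp add: M_set_def sign_mats_def)

lemma G1_set_iff:
  "D \<in> G1_set k \<longleftrightarrow> D \<in> carrier_mat (2 * k + 1) (2 * k + 1)
     \<and> (\<forall>i<2 * k + 1. \<forall>j<2 * k + 1. D $$ (i, j) \<in> {-1, 1}) \<and> det D \<noteq> 0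
     \<and> (\<forall>i<2 * k + 1. \<forall>j<k. D $$ (i, k + j) = D $$ (i, 0) * D $$ (i, j))"
proof (cases "D \<in> carrier_mat (2 * k + 1) (2 * k + 1)")
  case True
  have "(\<forall>j<k. col D (k + j) = schur_vec (col D 0) (col D j)) \<longleftrightarrow>
    (\<forall>i<2 * k + 1. \<forall>j<k. D $$ (i, k + j) = D $$ (i, 0) * D $$ (i, j))"
    using True by (auto simp: vec_eq_iff schur_vec_def)
  then show ?thesis
    using elements_mat_subset_iff[OF True, of "{-1, 1}"] True
    unfolding G1_set_def sign_mats_def by auto
qed (simp add: G1_set_def sign_mats_def)

text \<open>\<open>Theta\<close> is a \<open>Max\<close>, so it bounds determinants only over a
  finite set. Setting entries to 0 outside the index square leaves finitely many entry
  functions.\<close>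

lemma finite_M_set: "finite (M_set m)"
proof -
  let ?F = "{f. \<forall>x. (x \<in> {0..<m} \<times> {0..<m} \<longrightarrow> f x \<in> {-1, 1 :: real})
    \<and> (x \<notin> {0..<m} \<times> {0..<m} \<longrightarrow> f x = 0)}"
  have "M_set m \<subseteq> mat m m ` ?F"
  proof
    fix M assume M: "M \<in> M_set m"
    let ?f = "\<lambda>x. if x \<in> {0..<m} \<times> {0..<m} then M $$ x else 0"
    have "M = mat m m ?f" using M by (intro eq_matI) (auto simp: M_set_iff)
    moreover have "?f \<in> ?F" using M by (auto simp: M_set_iff)
    ultimately show "M \<in> mat m m ` ?F" by blast
  qed
  moreover have "finite ?F" by (rule finite_set_of_finite_funs) auto
  ultimately show ?thesis by (meson finite_imageI finite_subset)
qed

lemma abs_det_le_Theta: "M \<in> M_set m \<Longrightarrow> \<bar>det M\<bar> \<le> Theta m"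
  unfolding Theta_def using finite_M_set by (intro Max_ge) auto

section \<open>Determinant factorisation by column operations\<close>

text \<open>Only the rows from \<open>k\<close> on have a prescribed sign. The first
  \<open>k\<close> are left free so that the formula can also rule out a further row of sign
  \<open>- s\<close>.\<close>

lemma abs_det_split_rows:
  fixes D :: "real mat"
  assumes D: "D \<in> carrier_mat (2 * k + 1) (2 * k + 1)"
    and p: "p permutes {0..<2 * k + 1}"
    and s: "\<bar>s\<bar> = 1"
    and rel: "\<And>i j. i < 2 * k + 1 \<Longrightarrow> j < k \<Longrightarrow> D $$ (i, k + j) = D $$ (i, 0) * D $$ (i, j)"
    and lower: "\<And>i. k \<le> i \<Longrightarrow> i < 2 * k + 1 \<Longrightarrow> D $$ (p i, 0) = - s"
  shows "\<bar>det D\<bar> = \<bar>det (mat k k (\<lambda>(i, j). s * D $$ (p i, j) + D $$ (p i, k + j)))\<bar>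
    * \<bar>det (mat (k + 1) (k + 1) (\<lambda>(i, j). D $$ (p (k + i), k + j)))\<bar>"
proof -
  let ?n = "2 * k + 1"
  define E where "E = mat ?n ?n (\<lambda>(i, j). D $$ (p i, j))"
  \<comment> \<open>Multiplying by \<open>R\<close> on the right replaces column
    \<open>j < k\<close> by \<open>s\<close> times itself plus column \<open>k + j\<close> and keeps
    the other columns. \<open>R\<close> is lower triangular with diagonal entries \<open>s\<close>
    and 1.\<close>
  define R where "R = mat ?n ?n (\<lambda>(i, j). if i = j then (if i < k then s else 1)
    else if i = k + j \<and> j < k then 1 else 0)"
  define W where "W = mat k k (\<lambda>(i, j). s * D $$ (p i, j) + D $$ (p i, k + j))"
  define U where "U = mat k (k + 1) (\<lambda>(i, j). D $$ (p i, k + j))"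
  define B where "B = mat (k + 1) (k + 1) (\<lambda>(i, j). D $$ (p (k + i), k + j))"
  have E: "E \<in> carrier_mat ?n ?n" and R: "R \<in> carrier_mat ?n ?n"
    by (simp_all add: E_def R_def)
  have p_lt: "p i < ?n" if "i < ?n" for i
    using permutes_in_image[OF p, of i] that by simp
  have "det E = signof p * det D"
    unfolding E_def by (rule det_permute_rows[OF D p])
  then have absE: "\<bar>det E\<bar> = \<bar>det D\<bar>"
    by (simp add: abs_mult sign_def)
  have "det R = prod_list (diag_mat R)"
    by (rule det_lower_triangular[OF _ R]) (auto simp: R_def)
  also have "\<bar>\<dots>\<bar> = 1"
  proof -
    have "\<bar>x\<bar> = 1" if "x \<in> set (diag_mat R)" for x
      using that s by (auto simp: diag_mat_def R_def split: if_splits)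
    moreover have "\<bar>prod_list xs\<bar> = 1" if "\<And>x. x \<in> set xs \<Longrightarrow> \<bar>x\<bar> = 1" for xs :: "real list"
      using that by (induction xs) (auto simp: abs_mult)
    ultimately show ?thesis by blast
  qed
  finally have absR: "\<bar>det R\<bar> = 1" .
  have "E * R = four_block_mat W U (0\<^sub>m (k + 1) k) B" (is "_ = ?F")
  proof (rule eq_matI)
    fix i j assume "i < dim_row ?F" "j < dim_col ?F"
    then have i: "i < ?n" and j: "j < ?n" by (simp_all add: W_def B_def)
    have "(E * R) $$ (i, j) = (\<Sum>l = 0..<?n. E $$ (i, l) * R $$ (l, j))"
      using E R i j by (simp add: scalar_prod_def)
    also have "\<dots> = (if j < k then s * D $$ (p i, j) + D $$ (p i, k + j) else D $$ (p i, j))"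
    proof (cases "j < k")
      case True
      have "(\<Sum>l = 0..<?n. E $$ (i, l) * R $$ (l, j))
          = (\<Sum>l\<in>{j, k + j}. E $$ (i, l) * R $$ (l, j))"
        using True i j by (intro sum.mono_neutral_right) (auto simp: R_def)
      then show ?thesis using True i j by (auto simp: E_def R_def)
    next
      case False
      have "(\<Sum>l = 0..<?n. E $$ (i, l) * R $$ (l, j)) = (\<Sum>l\<in>{j}. E $$ (i, l) * R $$ (l, j))"
        using False i j by (intro sum.mono_neutral_right) (auto simp: R_def)
      then show ?thesis using False i j by (auto simp: E_def R_def)
    qed
    \<comment> \<open>In a row of sign \<open>- s\<close>, column \<open>k + j\<close> is
      \<open>- s\<close> times column \<open>j\<close>, so the sum cancels.\<close>
    also have "\<dots> = ?F $$ (i, j)"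
      using i j lower[of i] rel[OF p_lt[OF i], of j] by (auto simp: W_def U_def B_def)
    finally show "(E * R) $$ (i, j) = ?F $$ (i, j)" .
  qed (use E R in \<open>auto simp: W_def B_def\<close>)
  moreover have "det ?F = det W * det B"
    by (rule det_four_block_mat_lower_left_zero) (auto simp: W_def U_def B_def)
  ultimately have "\<bar>det E\<bar> * \<bar>det R\<bar> = \<bar>det W\<bar> * \<bar>det B\<bar>"
    using det_mult[OF E R] by (metis abs_mult)
  then show ?thesis unfolding absE absR W_def B_def by simp
qed

text \<open>In a row of sign \<open>s\<close>, both summands of the upper left entry equal
  \<open>D $$ (p i, k + j)\<close>, since \<open>s * s = 1\<close> in the reals. Each of the
  \<open>k\<close> rows thus contributes a factor 2.\<close>

lemma abs_det_two_sign_blocks: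
  fixes D :: "real mat"
  assumes D: "D \<in> carrier_mat (2 * k + 1) (2 * k + 1)"
    and p: "p permutes {0..<2 * k + 1}"
    and s: "\<bar>s\<bar> = 1"
    and rel: "\<And>i j. i < 2 * k + 1 \<Longrightarrow> j < k \<Longrightarrow> D $$ (i, k + j) = D $$ (i, 0) * D $$ (i, j)"
    and lower: "\<And>i. k \<le> i \<Longrightarrow> i < 2 * k + 1 \<Longrightarrow> D $$ (p i, 0) = - s"
    and upper: "\<And>i. i < k \<Longrightarrow> D $$ (p i, 0) = s"
  shows "\<bar>det D\<bar> = 2 ^ k * \<bar>det (mat k k (\<lambda>(i, j). D $$ (p i, k + j)))\<bar>
    * \<bar>det (mat (k + 1) (k + 1) (\<lambda>(i, j). D $$ (p (k + i), k + j)))\<bar>"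
proof -
  have p_lt: "p i < 2 * k + 1" if "i < k" for i
    using permutes_in_image[OF p, of i] that by simp
  have "mat k k (\<lambda>(i, j). s * D $$ (p i, j) + D $$ (p i, k + j))
      = 2 \<cdot>\<^sub>m mat k k (\<lambda>(i, j). D $$ (p i, k + j))"
    using rel[OF p_lt] upper by (intro eq_matI) auto
  then show ?thesis
    using abs_det_split_rows[OF D p s rel lower] by (simp add: abs_mult)
qed

section \<open>The upper bound\<close>

lemma G1_set_abs_det_le:
  assumes k: "k \<ge> 1" and D: "D \<in> G1_set k"
  shows "\<bar>det D\<bar> \<le> 2 ^ k * Theta k * Theta (k + 1)"
proof -
  let ?n = "2 * k + 1"
  have Dc: "D \<in> carrier_mat ?n ?n"
    and sgn: "\<And>i j. i < ?n \<Longrightarrow> j < ?n \<Longrightarrow> D $$ (i, j) \<in> {-1, 1}"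
    and det: "det D \<noteq> 0"
    and rel: "\<And>i j. i < ?n \<Longrightarrow> j < k \<Longrightarrow> D $$ (i, k + j) = D $$ (i, 0) * D $$ (i, j)"
    using D unfolding G1_set_iff by blast+
  define P where "P t = {i \<in> {0..<?n}. D $$ (i, 0) = t}" for t :: real
  have "P 1 \<union> P (-1) = {0..<?n}" using sgn[of _ 0] by (fastforce simp: P_def)
  moreover have "card (P 1 \<union> P (-1)) = card (P 1) + card (P (-1))"
    by (rule card_Un_disjoint) (auto simp: P_def)
  ultimately have "card (P 1) + card (P (-1)) = ?n" by simp
  then have "k + 1 \<le> card (P 1) \<or> k + 1 \<le> card (P (-1))" by linarith
  then obtain s :: real where s: "s \<in> {-1, 1}" and card: "k + 1 \<le> card (P (- s))"
    by (metis add.inverse_inverse insertCI)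
  obtain T where T: "T \<subseteq> P (- s)" "card T = k + 1"
    using obtain_subset_with_card_n[OF card] by blast
  \<comment> \<open>Row \<open>i\<close> of the permuted design is row \<open>p i\<close> of
    \<open>D\<close>, so the rows of \<open>T\<close> become the last \<open>k + 1\<close>.\<close>
  have "\<exists>p. p permutes {0..<?n} \<and> p ` {k..<?n} = T"
    by (rule ex_permutes_image_eq) (use T in \<open>auto simp: P_def\<close>)
  then obtain p where p: "p permutes {0..<?n}" and pT: "p ` {k..<?n} = T" by blast
  have p_lt: "p i < ?n" if "i < ?n" for i
    using permutes_in_image[OF p, of i] that by simp
  have lower: "D $$ (p i, 0) = - s" if "k \<le> i" "i < ?n" for i
  proof -
    have "p i \<in> T" unfolding pT[symmetric] using that by auto
    then show ?thesis using T by (auto simp: P_def)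
  qed
  have abs_s: "\<bar>s\<bar> = 1" using s by auto
  have upper: "D $$ (p i, 0) = s" if i: "i < k" for i
  proof (rule ccontr)
    assume "D $$ (p i, 0) \<noteq> s"
    then have "D $$ (p i, 0) = - s" using sgn[OF p_lt, of i 0] i s by auto
    then have "det (mat k k (\<lambda>(i, j). s * D $$ (p i, j) + D $$ (p i, k + j))) = 0"
      using i rel[OF p_lt, of i] by (intro det_eq_0_if_zero_row[OF _ i]) auto
    then show False using abs_det_split_rows[OF Dc p abs_s rel lower] det by simp
  qed
  let ?A = "mat k k (\<lambda>(i, j). D $$ (p i, k + j))"
  let ?B = "mat (k + 1) (k + 1) (\<lambda>(i, j). D $$ (p (k + i), k + j))"
  have eq: "\<bar>det D\<bar> = 2 ^ k * \<bar>det ?A\<bar> * \<bar>det ?B\<bar>"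
    by (rule abs_det_two_sign_blocks[OF Dc p abs_s rel lower upper])
  then have nz: "det ?A \<noteq> 0" "det ?B \<noteq> 0" using det by auto
  \<comment> \<open>Column \<open>k\<close> is the square of the sign column
    \<open>F\<^sub>1\<close>, hence the mean. It is the first column of both \<open>?A\<close> and
    \<open>?B\<close>.\<close>
  have one: "D $$ (p i, k) = 1" if "i < ?n" for i
    using rel[OF p_lt[OF that], of 0] sgn[OF p_lt[OF that], of 0] k by auto
  have "?A \<in> M_set k"
    unfolding M_set_iff using nz sgn[OF p_lt] one k by simp
  then have A: "\<bar>det ?A\<bar> \<le> Theta k" by (rule abs_det_le_Theta)
  have "?B \<in> M_set (k + 1)"
    unfolding M_set_iff using nz sgn[OF p_lt] one k by simp
  then have B: "\<bar>det ?B\<bar> \<le> Theta (k + 1)" by (rule abs_det_le_Theta)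
  \<comment> \<open>Monotonicity of the product needs this sign; it follows because
    \<open>Theta k\<close> bounds an absolute value.\<close>
  have "0 \<le> Theta k" using A by (rule order_trans[rotated]) simp
  then show ?thesis
    unfolding eq using A B by (intro mult_mono) auto
qed

section \<open>The design attaining the bound\<close>

lemma bordered_carrier:
  assumes "A \<in> carrier_mat n n" "c \<in> carrier_vec n" "r \<in> carrier_vec n"
  shows "bordered A c r \<in> carrier_mat (n + 1) (n + 1)"
  using assms by (auto simp: bordered_def)

lemma index_bordered:
  assumes "A \<in> carrier_mat n n" "c \<in> carrier_vec n" "r \<in> carrier_vec n"
    and "i < n + 1" "j < n + 1"
  shows "bordered A c r $$ (i, j) = (if i < n then if j < n then A $$ (i, j) else - (c $ i)
    else if j < n then r $ j else 1)"
  using assms by (auto simp: bordered_def mat_of_cols_index mat_of_row_def)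

theorem corollary3:
  fixes k :: nat and M\<^sub>0 N\<^sub>0 g\<^sub>0 :: "real mat" and c\<^sub>0 r\<^sub>0 v\<^sub>0 c' :: "real vec"
  assumes "k \<ge> 1"
    and "M\<^sub>0 \<in> carrier_mat k k" and "c\<^sub>0 \<in> carrier_vec k" and "r\<^sub>0 \<in> carrier_vec k"
    and "bordered M\<^sub>0 c\<^sub>0 r\<^sub>0 \<in> M_set (k + 1)"
    and "\<bar>det (bordered M\<^sub>0 c\<^sub>0 r\<^sub>0)\<bar> = Theta (k + 1)"
    and "N\<^sub>0 \<in> M_set k" and "\<bar>det N\<^sub>0\<bar> = Theta k"
    and "v\<^sub>0 = r\<^sub>0 @\<^sub>v r\<^sub>0"
    and "c' = c\<^sub>0 @\<^sub>v c\<^sub>0"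
    and "g\<^sub>0 = four_block_mat M\<^sub>0 M\<^sub>0 (- N\<^sub>0) N\<^sub>0"
  shows "d_optimal (G1_set k) (bordered g\<^sub>0 c' v\<^sub>0)
    \<and> \<bar>det (bordered g\<^sub>0 c' v\<^sub>0)\<bar> = 2 ^ k * Theta k * Theta (k + 1)"
proof -
  let ?n = "2 * k + 1"
  let ?b = "bordered M\<^sub>0 c\<^sub>0 r\<^sub>0"
  define D where "D = bordered g\<^sub>0 c' v\<^sub>0"
  have N: "N\<^sub>0 \<in> carrier_mat k k" using assms(7) by (simp add: M_set_iff)
  have g: "g\<^sub>0 \<in> carrier_mat (2 * k) (2 * k)"
    unfolding assms(11) using assms(2) N by (auto simp: mult_2)
  have c: "c' \<in> carrier_vec (2 * k)" and v: "v\<^sub>0 \<in> carrier_vec (2 * k)"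
    unfolding assms(9,10) using assms(3,4) by (auto simp: mult_2)
  have Dc: "D \<in> carrier_mat ?n ?n"
    unfolding D_def by (rule bordered_carrier[OF g c v])
  have b: "?b $$ (i, j) = (if i < k then if j < k then M\<^sub>0 $$ (i, j) else - (c\<^sub>0 $ i)
      else if j < k then r\<^sub>0 $ j else 1)" if "i < k + 1" "j < k + 1" for i j
    by (rule index_bordered[OF assms(2-4) that])
  \<comment> \<open>Here \<open>j = k\<close> is allowed and gives the extra main effect. In the
    middle rows it repeats \<open>- c\<^sub>0\<close>, which is the last column of
    \<open>?b\<close>.\<close>
  have D_right: "D $$ (i, k + j) = (if i < k then ?b $$ (i, j)
      else if i < 2 * k then (if j < k then N\<^sub>0 $$ (i - k, j) else ?b $$ (i - k, k))
      else ?b $$ (k, j))" if "i < ?n" "j < k + 1" for i j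
    unfolding D_def using that assms(2-4) N
    by (subst index_bordered[OF g c v]) (auto simp: b assms(9-11))
  have D_left: "D $$ (i, j) = (if i < k then ?b $$ (i, j)
      else if i < 2 * k then - (N\<^sub>0 $$ (i - k, j)) else ?b $$ (k, j))" if "i < ?n" "j < k" for i j
    unfolding D_def using that assms(2-4) N
    by (subst index_bordered[OF g c v]) (auto simp: b assms(9-11))
  have b_sgn: "?b $$ (i, j) \<in> {-1, 1}" if "i < k + 1" "j < k + 1" for i j
    using assms(5) that by (simp add: M_set_iff)
  have N_sgn: "N\<^sub>0 $$ (i, j) \<in> {-1, 1}" if "i < k" "j < k" for i j
    using assms(7) that by (simp add: M_set_iff)
  have b_one: "?b $$ (i, 0) = 1" if "i < k + 1" for i
    using assms(5) that by (simp add: M_set_iff)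
  have N_one: "N\<^sub>0 $$ (i, 0) = 1" if "i < k" for i
    using assms(7) that by (simp add: M_set_iff)
  \<comment> \<open>\<open>F\<^sub>1\<close> is -1 exactly on the rows of
    \<open>- N\<^sub>0\<close>, because \<open>N\<^sub>0\<close> starts with a column of
    ones.\<close>
  have D0: "D $$ (i, 0) = (if k \<le> i \<and> i < 2 * k then -1 else 1)" if "i < ?n" for i
    using D_left[OF that, of 0] assms(1) b_one N_one by auto
  have rel: "D $$ (i, k + j) = D $$ (i, 0) * D $$ (i, j)" if "i < ?n" "j < k" for i j
    using that D_left[OF that] D_right[of i j] D0[of i] by auto
  have sgn: "D $$ (i, j) \<in> {-1, 1}" if ij: "i < ?n" "j < ?n" for i j
  proof (cases "j < k")
    case True
    then show ?thesis
      using D_left[OF ij(1) True] b_sgn[of i j] b_sgn[of k j] N_sgn[of "i - k" j] ij by auto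
  next
    case False
    then have "k + (j - k) = j" "j - k < k + 1" using ij by auto
    then show ?thesis
      using D_right[OF ij(1), of "j - k"] b_sgn[of i "j - k"] b_sgn[of k "j - k"]
        b_sgn[of "i - k" k] N_sgn[of "i - k" "j - k"] ij by (auto split: if_splits)
  qed
  \<comment> \<open>Swapping the first two blocks of \<open>k\<close> rows puts the rows with
    \<open>N\<^sub>0\<close> on top, so the factorisation applies with \<open>s = -1\<close>. The
    remaining rows, restricted to the last \<open>k + 1\<close> columns, form \<open>?b\<close>. As
    an involution, \<open>p\<close> is its own inverse.\<close>
  define p where "p i = (if i < k then k + i else if i < 2 * k then i - k else i)" for i
  have "p permutes {0..<?n}"
    by (rule bij_imp_permutes, rule bij_betw_byWitness[of _ p]) (auto simp: p_def)
  then have "\<bar>det D\<bar> = 2 ^ k * \<bar>det (mat k k (\<lambda>(i, j). D $$ (p i, k + j)))\<bar>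
    * \<bar>det (mat (k + 1) (k + 1) (\<lambda>(i, j). D $$ (p (k + i), k + j)))\<bar>"
    by (rule abs_det_two_sign_blocks[OF Dc _ _ rel, of _ "-1"]) (auto simp: p_def D0)
  also have "mat k k (\<lambda>(i, j). D $$ (p i, k + j)) = N\<^sub>0"
    using N by (intro eq_matI) (auto simp: p_def D_right)
  also have "mat (k + 1) (k + 1) (\<lambda>(i, j). D $$ (p (k + i), k + j)) = ?b"
  proof -
    have "D $$ (p (k + i), k + j) = ?b $$ (i, j)" if "i < k + 1" "j < k + 1" for i j
      using that by (cases "i < k") (auto simp: p_def D_right less_Suc_eq)
    then show ?thesis
      using bordered_carrier[OF assms(2-4)] by (intro eq_matI) auto
  qed
  finally have det: "\<bar>det D\<bar> = 2 ^ k * Theta k * Theta (k + 1)"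
    unfolding assms(6,8) .
  \<comment> \<open>Both maxima are attained by the given non-singular matrices, so the determinant
    formula itself shows that \<open>D\<close> is non-singular.\<close>
  have "Theta k \<noteq> 0" "Theta (k + 1) \<noteq> 0"
    using assms(5-8) by (auto simp: M_set_iff)
  then have "det D \<noteq> 0" using det by auto
  then have "D \<in> G1_set k" unfolding G1_set_iff using Dc sgn rel by blast
  then have "d_optimal (G1_set k) D"
    unfolding d_optimal_def det using G1_set_abs_det_le[OF assms(1)] by blast
  with det show ?thesis unfolding D_def by blast
qed

end
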